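(* Every uniserial commutative hemiring $H$ is a nucleus hemiring.
   Context: A (commutative) hemiring $(H,+,\cdot)$ is a set with $(H,+)$ a commutative monoid with identity $0$, $(H,\cdot)$ a commutative semigroup, multiplication distributing over addition, and $0h=0$ for all $h\in H$. No multiplicative identity is assumed. An ideal of $H$ is a nonempty subset $I$ with $a+b\in I$ and $ha\in I$ for all $a,b\in I$, $h\in H$. An ideal $I$ is subtractive if $x+y\in I$ and $x\in I$ imply $y\in I$, for all $x,y\in H$. $H$ is uniserial if its ideals are linearly ordered by inclusion. $\operatorname{Id}(H)$ is the lattice of ideals of $H$ ordered by inclusion, with meet given by intersection. $\operatorname{scl}_H(I)$ is the intersection of all subtractive ideals of $H$ containing $I$. A nucleus map on a meet-semilattice $(P,\le)$ is a function $\nu:P\to P$ such that for all $x,y\in P$: $x\le\nu(x)$; $\nu(\nu(x))=\nu(x)$; $\nu(x\wedge y)=\nu(x)\wedge\nu(y)$. $H$ is a nucleus hemiring if $\operatorname{scl}_H$ is a nucleus map on $\operatorname{Id}(H)$. *)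

theory Defs
  imports Main
begin

(* The class comm_semiring_0 is exactly the class of commutative hemirings: a commutative
   additive monoid and a commutative multiplicative semigroup with distributivity and an
   absorbing zero, and no multiplicative identity. *)

definition hemiring_ideal :: "'a::comm_semiring_0 set \<Rightarrow> bool" where
  "hemiring_ideal I \<longleftrightarrow>
     I \<noteq> {} \<and> (\<forall>a\<in>I. \<forall>b\<in>I. a + b \<in> I) \<and> (\<forall>h. \<forall>a\<in>I. h * a \<in> I)"

definition subtractive :: "'a::comm_semiring_0 set \<Rightarrow> bool" where
  "subtractive I \<longleftrightarrow> (\<forall>x y. x + y \<in> I \<and> x \<in> I \<longrightarrow> y \<in> I)"

lemma hemiring_ideal_UNIV: "hemiring_ideal UNIV"
  by (simp add: hemiring_ideal_def)

lemma subtractive_UNIV: "subtractive UNIV"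
  by (simp add: subtractive_def)

lemma hemiring_ideal_zero: "hemiring_ideal I \<Longrightarrow> 0 \<in> I"
  unfolding hemiring_ideal_def by (metis all_not_in_conv mult_zero_left)

lemma hemiring_ideal_Inter:
  assumes "\<And>I. I \<in> S \<Longrightarrow> hemiring_ideal I"
  shows "hemiring_ideal (\<Inter>S)"
proof -
  have "0 \<in> \<Inter>S"
    using assms hemiring_ideal_zero by blast
  then have "\<Inter>S \<noteq> {}"
    by blast
  then show ?thesis
    using assms unfolding hemiring_ideal_def by blast
qed

lemma hemiring_ideal_Int: "hemiring_ideal I \<Longrightarrow> hemiring_ideal J \<Longrightarrow> hemiring_ideal (I \<inter> J)"
  using hemiring_ideal_Inter[of "{I, J}"] by auto

(* The lattice Id(H) of ideals, for H the hemiring on the type 'a. *)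
typedef (overloaded) 'a Id = "{I :: 'a::comm_semiring_0 set. hemiring_ideal I}"
  morphisms ideal_set Abs_Id
  using hemiring_ideal_UNIV by blast

setup_lifting type_definition_Id

instantiation Id :: (comm_semiring_0) semilattice_inf
begin

lift_definition less_eq_Id :: "'a Id \<Rightarrow> 'a Id \<Rightarrow> bool" is "(\<subseteq>)" .

lift_definition less_Id :: "'a Id \<Rightarrow> 'a Id \<Rightarrow> bool" is "(\<subset>)" .

lift_definition inf_Id :: "'a Id \<Rightarrow> 'a Id \<Rightarrow> 'a Id" is "(\<inter>)"
  by (rule hemiring_ideal_Int)

instance
  by standard (transfer; auto)+

end

lift_definition scl :: "'a::comm_semiring_0 Id \<Rightarrow> 'a Id" is
  "\<lambda>I. \<Inter>{J. hemiring_ideal J \<and> subtractive J \<and> I \<subseteq> J}"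
  by (rule hemiring_ideal_Inter) blast

definition nucleus_map :: "('p::semilattice_inf \<Rightarrow> 'p) \<Rightarrow> bool" where
  "nucleus_map \<nu> \<longleftrightarrow>
     (\<forall>x. x \<le> \<nu> x) \<and> (\<forall>x. \<nu> (\<nu> x) = \<nu> x) \<and> (\<forall>x y. \<nu> (inf x y) = inf (\<nu> x) (\<nu> y))"

(* The argument of type 'a itself stands for the hemiring H on the type 'a. *)

definition uniserial :: "'a::comm_semiring_0 itself \<Rightarrow> bool" where
  "uniserial H \<longleftrightarrow> (\<forall>I J :: 'a Id. I \<le> J \<or> J \<le> I)"

definition nucleus_hemiring :: "'a::comm_semiring_0 itself \<Rightarrow> bool" where
  "nucleus_hemiring H \<longleftrightarrow> nucleus_map (scl :: 'a Id \<Rightarrow> 'a Id)"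

end

(* A monotone map preserves binary meets of comparable elements, and the subtractive closure
   is a closure operator; so on a chain of ideals it is a nucleus. *)
theory Submission
  imports Defs
begin

text \<open>Only preservation of meets uses uniseriality: if I \<le> J, then the meet of I and J is
  I, and \<open>scl_mono\<close> makes the meet of their closures \<open>scl I\<close>; the other
  case is symmetric. The other two nucleus laws hold in every hemiring.\<close>

lemma scl_extensive: "I \<le> scl I"
  by transfer blast

lemma scl_mono: "I \<le> J \<Longrightarrow> scl I \<le> scl J"
  by transfer blast

text \<open>A subtractive ideal contains I iff it contains \<open>scl I\<close>, so both closures
  intersect the same family.\<close>

lemma scl_idem: "scl (scl I) = scl I"
  by transfer blast

theorem proposition4p13:
  assumes "uniserial TYPE('a::comm_semiring_0)"
  shows "nucleus_hemiring TYPE('a)"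
proof -
  have "scl (inf I J) = inf (scl I) (scl J)" for I J :: "'a Id"
  proof -
    consider "I \<le> J" | "J \<le> I"
      using assms unfolding uniserial_def by blast
    then show ?thesis
      by cases (simp_all add: scl_mono inf_absorb1 inf_absorb2)
  qed
  then show ?thesis
    unfolding nucleus_hemiring_def nucleus_map_def
    by (simp add: scl_extensive scl_idem)
qed

end
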